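(* Let $f(z)$ be an entire function of order strictly less than $1$ such that for a certain $\mu\in\mathbb N_0$, $$z^{-\mu}f(z)=\sum_{n=0}^\infty a_nz^n,\qquad a_0\cdot a_n>0\quad\forall n\in\mathbb N,$$ where the $a_n$ are real. Let $\{-\lambda_n\}_{n=1}^\infty$ be the sequence of nonzero zeros of $f$, listed with multiplicity, and assume that there is $\beta_0\in(0,1)$ with $$\Re(\lambda_n)\ge\beta_0|\lambda_n|\quad\forall n\in\mathbb N,$$ and that $\inf\{\Re(\lambda_n): n\in\mathbb N\}>1$. Put $F(z)=\dfrac{f(z)}{a_0z^\mu}$ and $$m_k=\frac{(-1)^{k+1}}{(k+1)!}\left(\frac{F'(x)}{F(x)}\right)^{(k+1)}\bigg|_{x=0}=\sum_{n=1}^\infty\frac{1}{\lambda_n^{k+2}},\qquad k\in\mathbb N_0 .$$ If $$(-1)^k\Delta^km_n=\sum_{j=1}^\infty\frac1{\lambda_j^{n+2}}\left(1-\frac1{\lambda_j}\right)^k\ge0\qquad\forall n,k\in\mathbb N_0,$$ then all the nonzero zeros of $f(z)$ are negative real numbers.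
   Context: $\mathbb N=\{1,2,\dots\}$ and $\mathbb N_0=\{0,1,2,\dots\}$. $\Delta$ is the forward difference operator in the index: $\Delta m_n=m_{n+1}-m_n$, so $(-1)^k\Delta^k m_n=\sum_{j=0}^k(-1)^j\binom kj m_{n+j}$. *)

theory Defs
  imports "HOL-Complex_Analysis.Complex_Analysis"
begin

definition max_modulus :: "(complex \<Rightarrow> complex) \<Rightarrow> real \<Rightarrow> real" where
  "max_modulus f r = (SUP z\<in>sphere 0 r. norm (f z))"

text \<open>
  For constant \<open>f\<close> the quotient is eventually a constant divided by \<open>ln r\<close>, so
  the order is \<open>0\<close>, as usual; for non-constant entire \<open>f\<close> both logarithms are eventually
  taken of positive numbers, by Liouville's theorem.
\<close>
definition entire_order :: "(complex \<Rightarrow> complex) \<Rightarrow> ereal" where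
  "entire_order f = Limsup at_top (\<lambda>r. ereal (ln (ln (max_modulus f r)) / ln r))"

definition enumerates_nonzero_zeros :: "(complex \<Rightarrow> complex) \<Rightarrow> (nat \<Rightarrow> complex) \<Rightarrow> bool" where
  "enumerates_nonzero_zeros f x \<longleftrightarrow>
     (\<forall>n. x n \<noteq> 0 \<and> f (x n) = 0) \<and>
     (\<forall>z. z \<noteq> 0 \<and> f z = 0 \<longrightarrow> finite {n. x n = z} \<and> int (card {n. x n = z}) = zorder f z)"

definition forward_diff :: "(nat \<Rightarrow> 'a::ab_group_add) \<Rightarrow> nat \<Rightarrow> 'a" where
  "forward_diff m n = m (Suc n) - m n"

end

theory Submission
  imports Defs "HOL-Real_Asymp.Real_Asymp"
begin

text \<open>
  Let \<open>P\<^sub>R\<close> be the product of the factors \<open>1 + z / \<lambda>\<^sub>n\<close> with \<open>\<bar>\<lambda>\<^sub>n\<bar> < R\<close>. The quotient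
  \<open>G = F / P\<^sub>R\<close> has no zeros in the disc of radius \<open>R\<close>, and there \<open>\<bar>G\<bar>\<close> is at most the maximum of \<open>\<bar>F\<bar>\<close>
  on the circle of radius \<open>2 R\<close>, since every factor of \<open>P\<^sub>R\<close> has modulus at least \<open>1\<close> on that circle.
  As the order is below \<open>1\<close>, the Borel-Caratheodory inequality makes all derivatives of \<open>log G\<close> at \<open>0\<close>
  tend to \<open>0\<close> as \<open>R\<close> grows, so the partial sums over \<open>\<bar>\<lambda>\<^sub>n\<bar> < R\<close> of the powers of \<open>1 / \<lambda>\<^sub>n\<close>
  converge to the Taylor coefficients of \<open>F' / F\<close>. For the first power, the sector condition turns
  this into absolute convergence, which frees the sums from the order of summation.

  For the reality of the zeros, put \<open>t\<^sub>j = 1 / \<lambda>\<^sub>j\<close> and let \<open>\<zeta>\<close> have modulus \<open>1\<close>. By the binomial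
  theorem, \<open>\<Sum>\<^sub>j t\<^sub>j\<^sup>2 (1 - t\<^sub>j + t\<^sub>j \<zeta>)\<^sup>N\<close> is a combination of the nonnegative differences with weights whose
  moduli do not depend on \<open>\<zeta>\<close>, so it is bounded by \<open>m\<^sub>0\<close>, its value at \<open>\<zeta> = 1\<close>. Power sums that are bounded
  in \<open>N\<close> force \<open>\<bar>1 - t\<^sub>j + t\<^sub>j \<zeta>\<bar> \<le> 1\<close> for every \<open>j\<close>, and \<open>\<zeta> \<rightarrow> 1\<close> from both sides on the unit circle
  gives \<open>Im t\<^sub>j = 0\<close>.
\<close>


section \<open>Zeros of entire functions and finite products over a disc\<close>

text \<open>A nonconstant entire function has finitely many distinct zeros in a closed disc, and the
  enumeration repeats each only finitely often. Without this, sums over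
  \<open>norm (x n) < R\<close> would take the default value 0.\<close>

lemma finite_zeros_in_ball:
  assumes holo: "F holomorphic_on UNIV" and F0: "F 0 \<noteq> 0"
    and enum: "enumerates_nonzero_zeros F x"
  shows "finite {n. norm (x n) < R}"
proof -
  have x: "x n \<noteq> 0" "F (x n) = 0" for n
    using enum by (auto simp: enumerates_nonzero_zeros_def)
  have "\<not> F constant_on UNIV"
    using F0 x(2)[of 0] by (force simp: constant_on_def)
  then have "finite {z\<in>cball 0 R. F z = 0}"
    using holo by (intro holomorphic_compact_finite_zeros[of _ UNIV]) auto
  moreover have "finite {n. x n = z}" if "F z = 0" for z
    using enum that F0 by (cases "z = 0") (auto simp: enumerates_nonzero_zeros_def)
  ultimately have "finite (\<Union>z\<in>{z\<in>cball 0 R. F z = 0}. {n. x n = z})"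
    by blast
  then show ?thesis
    by (rule rev_finite_subset) (use x in auto)
qed

text \<open>The enumeration only equates the number of indices of a zero with
  \<open>zorder F z\<close>. This order is positive because \<open>F 0 \<noteq> 0\<close> excludes
  that \<open>F\<close> vanishes identically near \<open>z\<close>.\<close>

lemma enumerated_zero:
  assumes holo: "F holomorphic_on UNIV" and F0: "F 0 \<noteq> 0"
    and enum: "enumerates_nonzero_zeros F x" and z: "F z = 0"
  obtains n where "x n = z"
proof -
  have "\<forall>\<^sub>F w in at z. F w \<noteq> 0"
    using non_zero_neighbour_alt[OF holo, of z 0] F0 connected_UNIV by auto
  then have "zorder F z > 0"
    using zorder_pos_iff[OF holo, of z] z by (simp add: eventually_frequently)
  moreover have "int (card {n. x n = z}) = zorder F z"
    using enum z F0 by (cases "z = 0") (auto simp: enumerates_nonzero_zeros_def)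
  ultimately have "{n. x n = z} \<noteq> {}"
    by force
  then show ?thesis using that by blast
qed

lemma zorder_one_minus_divide:
  fixes c w :: complex
  assumes "c \<noteq> 0"
  shows "zorder (\<lambda>z. 1 - z / c) w = (if c = w then 1 else 0)"
proof (cases "c = w")
  case True
  have "zorder (\<lambda>z. 1 - z / c) w = 1"
    by (rule zorder_eqI[of UNIV _ "\<lambda>_. - 1 / c"]) (use assms True in \<open>auto simp: field_simps\<close>)
  then show ?thesis using True by simp
next
  case False
  then have "zorder (\<lambda>z. 1 - z / c) w = 0"
    using assms by (intro zorder_eq_0I analytic_intros) auto
  then show ?thesis using False by simp
qed

lemma zorder_prod_one_minus_divide:
  fixes x :: "nat \<Rightarrow> complex"
  assumes "finite S" and x: "\<And>n. n \<in> S \<Longrightarrow> x n \<noteq> 0"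
  shows "zorder (\<lambda>z. \<Prod>n\<in>S. 1 - z / x n) w = int (card {n\<in>S. x n = w})"
proof -
  \<comment> \<open>Additivity of \<open>zorder\<close> needs a product without zeros in a punctured
    neighbourhood of \<open>w\<close>; removing the finitely many other zeros provides one.\<close>
  have "open (- (x ` S - {w}))"
    using assms by (intro open_Compl finite_imp_closed) simp
  then have "eventually (\<lambda>z. z \<in> - (x ` S - {w}) - {w}) (at w)"
    by (intro eventually_at_in_open) auto
  then have "eventually (\<lambda>z. (\<Prod>n\<in>S. 1 - z / x n) \<noteq> 0) (at w)"
    by eventually_elim (use assms in \<open>auto simp: field_simps\<close>)
  then have "zorder (\<lambda>z. \<Prod>n\<in>S. 1 - z / x n) w = (\<Sum>n\<in>S. zorder (\<lambda>z. 1 - z / x n) w)"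
    using x by (intro zorder_prod_analytic) (auto intro!: analytic_intros)
  also have "\<dots> = (\<Sum>n\<in>S. if x n = w then 1 else 0)"
    using x by (intro sum.cong) (auto simp: zorder_one_minus_divide)
  also have "\<dots> = int (card {n\<in>S. x n = w})"
    using assms by (simp flip: sum.inter_filter)
  finally show ?thesis .
qed

text \<open>Equal orders make the quotient of \<open>F\<close> by its zero factors holomorphic.
  Radius \<open>3 * R\<close> leaves room for the circle of radius \<open>2 * R\<close>, where the
  maximum principle is applied later.\<close>

lemma factor_zeros_in_ball:
  assumes holo: "F holomorphic_on UNIV" and F0: "F 0 \<noteq> 0"
    and enum: "enumerates_nonzero_zeros F x" and R: "R > 0"
  obtains G where "G holomorphic_on ball 0 (3 * R)" "\<And>z. z \<in> ball 0 R \<Longrightarrow> G z \<noteq> 0"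
    "\<And>z. z \<in> ball 0 (3 * R) \<Longrightarrow> F z = (\<Prod>n | norm (x n) < R. 1 - z / x n) * G z"
proof -
  define S where "S r = {n. norm (x n) < r}" for r
  have fin: "finite (S r)" for r
    unfolding S_def by (rule finite_zeros_in_ball[OF holo F0 enum])
  have x: "x n \<noteq> 0" "F (x n) = 0" for n
    using enum by (auto simp: enumerates_nonzero_zeros_def)
  have card: "card {n. x n = z} = zorder F z" if "F z = 0" for z
    using enum that F0 by (cases "z = 0") (auto simp: enumerates_nonzero_zeros_def)
  have ex: "\<exists>n. x n = z" if "F z = 0" for z
    using that enumerated_zero[OF holo F0 enum] by metis
  define P where "P = (\<lambda>z. \<Prod>n\<in>S (3 * R). 1 - z / x n)"
  text \<open>The quotient by all zeros in the larger disc is multiplied back by the factors whose zeros lie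
    outside the smaller one.\<close>
  obtain H where H: "H holomorphic_on ball 0 (3 * R)" "\<And>z. z \<in> ball 0 (3 * R) \<Longrightarrow> H z \<noteq> 0"
    "\<And>z. z \<in> ball 0 (3 * R) \<Longrightarrow> F z = H z * P z"
  proof (rule holomorphic_zorder_factorization[of F "ball 0 (3 * R)" P])
    show "F holomorphic_on ball 0 (3 * R)"
      using holo by (rule holomorphic_on_subset) auto
    show "P holomorphic_on ball 0 (3 * R)"
      using x unfolding P_def by (auto intro!: holomorphic_intros)
    fix z :: complex assume z: "z \<in> ball 0 (3 * R)"
    have "P z = 0 \<longleftrightarrow> (\<exists>n\<in>S (3 * R). x n = z)"
      using fin x by (auto simp: P_def field_simps)
    also have "\<dots> \<longleftrightarrow> F z = 0"
      using z ex[of z] x(2) by (auto simp: S_def)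
    finally show *: "P z = 0 \<longleftrightarrow> F z = 0" .
    have "zorder P z = int (card {n\<in>S (3 * R). x n = z})"
      unfolding P_def using fin x by (intro zorder_prod_one_minus_divide) auto
    also have "{n\<in>S (3 * R). x n = z} = {n. x n = z}"
      using z by (auto simp: S_def)
    also have "int (card \<dots>) = zorder F z"
    proof (cases "F z = 0")
      case False
      then have "{n. x n = z} = {}" using x(2) by auto
      moreover have "zorder F z = 0"
        using False holo by (intro zorder_eq_0I) (auto simp: analytic_on_open holomorphic_on_imp_analytic_at)
      ultimately show ?thesis by simp
    qed (use card in auto)
    finally show "zorder P z = zorder F z" .
  qed auto
  show ?thesis
  proof (rule that)
    let ?G = "\<lambda>z. (\<Prod>n\<in>S (3 * R) - S R. 1 - z / x n) * H z"
    show "?G holomorphic_on ball 0 (3 * R)"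
      using x H by (auto intro!: holomorphic_intros)
    show "?G z \<noteq> 0" if "z \<in> ball 0 R" for z
      using that H(2)[of z] R fin x by (auto simp: S_def field_simps)
    have "P z = (\<Prod>n\<in>S R. 1 - z / x n) * (\<Prod>n\<in>S (3 * R) - S R. 1 - z / x n)" for z
      unfolding P_def using fin R
      by (subst prod.subset_diff[of "S R" "S (3 * R)"]) (auto simp: S_def)
    then show "F z = (\<Prod>n | norm (x n) < R. 1 - z / x n) * ?G z" if "z \<in> ball 0 (3 * R)" for z
      using H(3)[OF that] by (simp add: S_def mult_ac)
  qed
qed

section \<open>Bounds and formulas for higher derivatives\<close>

text \<open>The map sending \<open>w\<close> to \<open>w / (2 * A - w)\<close> takes the half-plane
  \<open>Re w < A\<close> into the unit disc. The Schwarz lemma then bounds \<open>h\<close> by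
  \<open>2 * A\<close> on the circle of radius \<open>R / 2\<close>, and Cauchy's inequality does
  the rest.\<close>

lemma Borel_Caratheodory_deriv:
  assumes holo: "h holomorphic_on ball 0 R" and R: "R > 0" and h0: "h 0 = 0"
    and A: "A > 0" and Re_le: "\<And>z. z \<in> ball 0 R \<Longrightarrow> Re (h z) < A"
  shows "norm ((deriv ^^ k) h 0) \<le> fact k * (2 * A) / (R / 2) ^ k"
proof (rule Cauchy_inequality)
  show "h holomorphic_on ball 0 (R / 2)"
    using holo by (rule holomorphic_on_subset) (use R in auto)
  show "continuous_on (cball 0 (R / 2)) h"
    using holo by (intro holomorphic_on_imp_continuous_on, rule holomorphic_on_subset) (use R in auto)
  show "R / 2 > 0" using R by simp
  fix z :: complex assume "norm (0 - z) = R / 2"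
  then have z: "norm z = R / 2" by simp
  text \<open>Since \<open>Re (h w) < A\<close>, the point \<open>h w\<close> is closer to \<open>0\<close> than to \<open>2 * A\<close>.\<close>
  define \<phi> where "\<phi> w = h (of_real R * w) / (of_real (2 * A) - h (of_real R * w))" for w
  have mem: "of_real R * w \<in> ball 0 R" if "norm w < 1" for w :: complex
    using that R by (simp add: norm_mult)
  have den: "norm (h u) < norm (of_real (2 * A) - h u)" if "u \<in> ball 0 R" for u
  proof -
    have "(Re (h u))\<^sup>2 < (2 * A - Re (h u))\<^sup>2"
    proof -
      have "(2 * A - Re (h u))\<^sup>2 - (Re (h u))\<^sup>2 = 4 * A * (A - Re (h u))"
        by (simp add: power2_eq_square algebra_simps)
      also have "\<dots> > 0" using A Re_le[OF that] by simp
      finally show ?thesis by simp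
    qed
    then show ?thesis
      by (simp add: cmod_def)
  qed
  have "norm (\<phi> (z / of_real R)) \<le> norm (z / of_real R)"
  proof (rule Schwarz_Lemma)
    have "h \<circ> (\<lambda>w. of_real R * w) holomorphic_on ball 0 1"
      using mem by (intro holomorphic_on_compose_gen[OF _ holo] holomorphic_intros) auto
    then have "(\<lambda>w. h (of_real R * w)) holomorphic_on ball 0 1"
      by (simp add: o_def)
    then show "\<phi> holomorphic_on ball 0 1"
      unfolding \<phi>_def using den mem by (intro holomorphic_intros) fastforce+
    show "\<phi> 0 = 0" by (simp add: \<phi>_def h0)
    show "norm (\<phi> w) < 1" if "norm w < 1" for w
      using den[OF mem[OF that]] by (simp add: \<phi>_def norm_divide divide_less_eq_1)
    show "norm (z / of_real R) < 1" using z R by (simp add: norm_divide)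
  qed
  then have "norm (h z) / norm (of_real (2 * A) - h z) \<le> 1 / 2"
    using z R by (simp add: \<phi>_def norm_divide)
  moreover have "norm (of_real (2 * A) - h z) > 0"
    using den[of z] z R by (smt (verit) norm_ge_zero mem_ball_0 field_sum_of_halves)
  ultimately have "2 * norm (h z) \<le> norm (of_real (2 * A) - h z)"
    by (simp add: field_simps)
  also have "\<dots> \<le> 2 * A + norm (h z)"
    using norm_triangle_ineq4[of "of_real (2 * A)" "h z"] A by simp
  finally show "norm (h z) \<le> 2 * A" by simp
qed

lemma higher_deriv_inverse_linear:
  fixes c :: complex
  assumes "z \<noteq> c"
  shows "(deriv ^^ k) (\<lambda>z. 1 / (z - c)) z = (- 1) ^ k * fact k * inverse (z - c) ^ (k + 1)"
  using assms
proof (induction k arbitrary: z)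
  case (Suc k)
  have inv: "((\<lambda>z. inverse (z - c)) has_field_derivative - (inverse (z - c))\<^sup>2) (at z)"
    using Suc.prems by (auto intro!: derivative_eq_intros simp: power2_eq_square)
  have "((deriv ^^ k) (\<lambda>z. 1 / (z - c)) has_field_derivative
          (- 1) ^ Suc k * fact (Suc k) * inverse (z - c) ^ (Suc k + 1)) (at z)"
  proof (rule has_field_derivative_transform_within_open)
    show "((\<lambda>z. (- 1) ^ k * fact k * inverse (z - c) ^ (k + 1)) has_field_derivative
            (- 1) ^ Suc k * fact (Suc k) * inverse (z - c) ^ (Suc k + 1)) (at z)"
      by (rule DERIV_cong[OF DERIV_cmult[OF DERIV_power[OF inv]]]) (simp add: power2_eq_square)
    show "open (- {c})" "z \<in> - {c}" using Suc.prems by auto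
  qed (use Suc.IH in auto)
  then show ?case by (simp add: DERIV_imp_deriv)
qed (simp add: divide_inverse)

lemma higher_deriv_sum_holomorphic:
  fixes f :: "'i \<Rightarrow> complex \<Rightarrow> complex"
  assumes "\<And>i. i \<in> I \<Longrightarrow> f i holomorphic_on S" "open S" "z \<in> S"
  shows "(deriv ^^ k) (\<lambda>w. \<Sum>i\<in>I. f i w) z = (\<Sum>i\<in>I. (deriv ^^ k) (f i) z)"
  using assms
proof (induction I rule: infinite_finite_induct)
  case (insert i I)
  then show ?case
    by (simp add: higher_deriv_add[where S = S] holomorphic_on_sum)
qed auto


section \<open>Logarithmic derivative and power sums of the zeros\<close>

text \<open>Near 0 the logarithmic derivative is the sum of \<open>1 / (z - x n)\<close> over the
  zeros in the disc plus the derivative of log G. The error is thus governed by derivative number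
  \<open>k + 1\<close> of log G, which explains the exponent.\<close>

lemma log_deriv_partial_sum_bound:
  assumes holo: "F holomorphic_on UNIV" and F0: "F 0 = 1"
    and enum: "enumerates_nonzero_zeros F x" and R: "R > 0" and A: "A \<ge> 0"
    and bound: "\<And>z. norm z = 2 * R \<Longrightarrow> norm (F z) \<le> exp A"
  shows "norm ((- 1) ^ k / fact k * (deriv ^^ k) (\<lambda>z. deriv F z / F z) 0
            - (\<Sum>n | norm (x n) < R. 1 / (- x n) ^ (k + 1)))
          \<le> real (k + 1) * (2 * (A + 1)) / (R / 2) ^ (k + 1)"
proof -
  define S where "S = {n. norm (x n) < R}"
  have fin: "finite S"
    unfolding S_def using finite_zeros_in_ball[OF holo _ enum] F0 by simp
  have x: "x n \<noteq> 0" "F (x n) = 0" for n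
    using enum by (auto simp: enumerates_nonzero_zeros_def)
  obtain G where G: "G holomorphic_on ball 0 (3 * R)" "\<And>z. z \<in> ball 0 R \<Longrightarrow> G z \<noteq> 0"
    and FG: "\<And>z. z \<in> ball 0 (3 * R) \<Longrightarrow> F z = (\<Prod>n\<in>S. 1 - z / x n) * G z"
    using factor_zeros_in_ball[OF holo _ enum R] F0 unfolding S_def by (metis zero_neq_one)
  have G0: "G 0 = 1"
    using FG[of 0] R F0 by simp
  have G_le: "norm (G z) \<le> exp A" if z: "z \<in> ball 0 R" for z
  proof (rule maximum_modulus_frontier[where f = G and S = "ball 0 (2 * R)"])
    show "G holomorphic_on interior (ball 0 (2 * R))"
      using R by (intro holomorphic_on_subset[OF G(1)]) auto
    show "continuous_on (closure (ball 0 (2 * R))) G"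
      using R by (intro holomorphic_on_imp_continuous_on holomorphic_on_subset[OF G(1)]) auto
    show "z \<in> ball 0 (2 * R)" using z R by auto
    fix w :: complex assume "w \<in> frontier (ball 0 (2 * R))"
    then have w: "norm w = 2 * R" using R by simp
    have "norm (1 - w / x n) \<ge> 1" if "n \<in> S" for n
    proof -
      have "norm (w / x n) \<ge> 2"
        using that w x[of n] by (simp add: S_def norm_divide field_simps)
      then show ?thesis
        using norm_triangle_ineq2[of "w / x n" 1] by (simp add: norm_minus_commute)
    qed
    then have "norm (\<Prod>n\<in>S. 1 - w / x n) \<ge> 1"
      unfolding prod_norm[symmetric] by (intro prod_ge_1)
    then have "norm (G w) \<le> norm (\<Prod>n\<in>S. 1 - w / x n) * norm (G w)"
      by (intro mult_le_cancel_right1[THEN iffD2]) auto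
    also have "\<dots> = norm (F w)"
      using FG[of w] w R by (simp add: norm_mult)
    finally show "norm (G w) \<le> exp A"
      using bound[OF w] by simp
  qed auto
  obtain g where g: "g holomorphic_on ball 0 R" "\<And>z. z \<in> ball 0 R \<Longrightarrow> exp (g z) = G z"
  proof (rule holomorphic_logarithm_exists[of "ball 0 R" G 0])
    show "G holomorphic_on ball 0 R"
      using G(1) by (rule holomorphic_on_subset) (use R in auto)
  qed (use G R in auto)
  \<comment> \<open>Subtracting \<open>g 0\<close> gives \<open>h 0 = 0\<close>, as the
    Borel-Caratheodory bound requires; \<open>exp (g 0) = G 0 = 1\<close>, so the exponential is
    unchanged.\<close>
  define h where "h z = g z - g 0" for z
  have h: "h holomorphic_on ball 0 R"
    unfolding h_def using g by (intro holomorphic_intros)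
  have exp_h: "exp (h z) = G z" if "z \<in> ball 0 R" for z
    using g(2)[OF that] g(2)[of 0] R G0 by (simp add: h_def exp_diff)
  \<comment> \<open>Using \<open>A + 1\<close> instead of \<open>A\<close> makes the bound on the
    real part strict and the constant positive even if \<open>A = 0\<close>.\<close>
  have h_bound: "norm ((deriv ^^ k) (deriv h) 0) \<le> fact (Suc k) * (2 * (A + 1)) / (R / 2) ^ Suc k"
    unfolding funpow_Suc_right[symmetric, THEN fun_cong, unfolded o_apply]
  proof (rule Borel_Caratheodory_deriv[OF h R])
    show "h 0 = 0" by (simp add: h_def)
    fix z :: complex assume z: "z \<in> ball 0 R"
    have "exp (Re (h z)) \<le> exp A"
      using G_le[OF z] exp_h[OF z] by (metis norm_exp_eq_Re)
    then show "Re (h z) < A + 1" by simp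
  qed (use A in auto)
  \<comment> \<open>Higher derivatives at 0 may be compared only if the functions agree on an open
    neighbourhood; \<open>U\<close> is one that avoids the poles.\<close>
  define U where "U = {z\<in>ball 0 R. F z \<noteq> 0}"
  have U: "open U" "0 \<in> U"
  proof -
    have "open (F -` (- {0}))"
      using holo by (intro open_vimage holomorphic_on_imp_continuous_on) auto
    then have "open (F -` (- {0}) \<inter> ball 0 R)" by blast
    also have "F -` (- {0}) \<inter> ball 0 R = U" by (auto simp: U_def)
    finally show "open U" .
  qed (use F0 R in \<open>auto simp: U_def\<close>)
  have log_deriv: "deriv F z / F z = (\<Sum>n\<in>S. 1 / (z - x n)) + deriv h z" if z: "z \<in> U" for z
  proof -
    have ne: "1 - z / x n \<noteq> 0" for n
      using z x[of n] by (auto simp: U_def field_simps)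
    have FE: "F w = (\<Prod>n\<in>S. 1 - w / x n) * exp (h w)" if "w \<in> U" for w
      using that FG[of w] exp_h[of w] R by (auto simp: U_def)
    have dh: "(h has_field_derivative deriv h z) (at z)"
      using h z by (intro holomorphic_derivI[of h "ball 0 R"]) (auto simp: U_def)
    have "((\<lambda>w. (\<Prod>n\<in>S. 1 - w / x n) * exp (h w)) has_field_derivative
            (\<Prod>n\<in>S. 1 - z / x n) * (\<Sum>n\<in>S. (- 1 / x n) / (1 - z / x n)) * exp (h z)
            + exp (h z) * deriv h z * (\<Prod>n\<in>S. 1 - z / x n)) (at z)"
      using ne x dh by (intro DERIV_mult has_field_derivative_prod' derivative_eq_intros) auto
    then have "(F has_field_derivative
            (\<Prod>n\<in>S. 1 - z / x n) * (\<Sum>n\<in>S. (- 1 / x n) / (1 - z / x n)) * exp (h z)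
            + exp (h z) * deriv h z * (\<Prod>n\<in>S. 1 - z / x n)) (at z)"
      by (rule has_field_derivative_transform_within_open[OF _ U(1) z]) (simp add: FE)
    then have "deriv F z = F z * ((\<Sum>n\<in>S. (- 1 / x n) / (1 - z / x n)) + deriv h z)"
      using FE[OF z] by (simp add: DERIV_imp_deriv algebra_simps)
    moreover have "(- 1 / x n) / (1 - z / x n) = 1 / (z - x n)" for n
      using x[of n] ne[of n] by (simp add: field_simps)
    ultimately show ?thesis
      using z by (simp add: U_def)
  qed
  have hol: "(\<lambda>z. 1 / (z - x n)) holomorphic_on U" for n
    using x by (intro holomorphic_intros) (auto simp: U_def)
  have hol_h': "deriv h holomorphic_on U"
    by (rule holomorphic_deriv[OF holomorphic_on_subset[OF h]]) (use U in \<open>auto simp: U_def\<close>)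
  have "(deriv ^^ k) (\<lambda>z. deriv F z / F z) 0 = (deriv ^^ k) (\<lambda>z. (\<Sum>n\<in>S. 1 / (z - x n)) + deriv h z) 0"
  proof (rule higher_deriv_transform_within_open[of _ U])
    show "(\<lambda>z. deriv F z / F z) holomorphic_on U"
      using holo by (intro holomorphic_intros holomorphic_on_subset[OF holo] holomorphic_on_subset[OF holomorphic_deriv[OF holo]])
        (auto simp: U_def)
  qed (use U log_deriv hol hol_h' in \<open>auto intro!: holomorphic_on_add holomorphic_on_sum\<close>)
  also have "\<dots> = (\<Sum>n\<in>S. (deriv ^^ k) (\<lambda>z. 1 / (z - x n)) 0) + (deriv ^^ k) (deriv h) 0"
    using U hol hol_h'
    by (simp add: higher_deriv_add[of _ U] higher_deriv_sum_holomorphic[of _ _ U] holomorphic_on_sum)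
  also have "(\<Sum>n\<in>S. (deriv ^^ k) (\<lambda>z. 1 / (z - x n)) 0)
               = (\<Sum>n\<in>S. (- 1) ^ k * fact k * (1 / (- x n) ^ (k + 1)))"
  proof (intro sum.cong refl)
    fix n
    show "(deriv ^^ k) (\<lambda>z. 1 / (z - x n)) 0 = (- 1) ^ k * fact k * (1 / (- x n) ^ (k + 1))"
      using higher_deriv_inverse_linear[of 0 "x n" k] x(1)[of n]
      by (simp del: power_Suc inverse_minus_eq add: power_inverse divide_inverse)
  qed
  finally have eq: "(deriv ^^ k) (\<lambda>z. deriv F z / F z) 0
      = (- 1) ^ k * fact k * (\<Sum>n\<in>S. 1 / (- x n) ^ (k + 1)) + (deriv ^^ k) (deriv h) 0"
    by (simp only: sum_distrib_left)
  have "(- 1) ^ k / fact k * (deriv ^^ k) (\<lambda>z. deriv F z / F z) 0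
          - (\<Sum>n\<in>S. 1 / (- x n) ^ (k + 1)) = (- 1) ^ k / fact k * (deriv ^^ k) (deriv h) 0"
    unfolding eq by (simp add: field_simps flip: power_mult_distrib)
  also have "norm \<dots> = norm ((deriv ^^ k) (deriv h) 0) / fact k"
    by (simp add: norm_mult norm_divide norm_power)
  also have "\<dots> \<le> (fact (Suc k) * (2 * (A + 1)) / (R / 2) ^ Suc k) / fact k"
    using h_bound by (intro divide_right_mono) auto
  also have "\<dots> = real (k + 1) * (2 * (A + 1)) / (R / 2) ^ (k + 1)"
    by simp
  finally show ?thesis by (simp add: S_def)
qed

text \<open>With log F bounded by a constant plus \<open>(2 * R) powr \<rho>\<close>, the error is
  of size at most \<open>R powr (\<rho> - k - 1)\<close> up to a constant. Since \<rho> < 1, it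
  vanishes already for \<open>k = 0\<close>.\<close>

lemma log_deriv_partial_sum_tendsto:
  assumes holo: "F holomorphic_on UNIV" and F0: "F 0 = 1"
    and enum: "enumerates_nonzero_zeros F x" and \<rho>: "0 < \<rho>" "\<rho> < 1"
    and growth: "\<forall>\<^sub>F r in at_top. \<forall>z. norm z = r \<longrightarrow> norm (F z) \<le> C * exp (r powr \<rho>)"
  shows "((\<lambda>R. \<Sum>n | norm (x n) < R. 1 / (- x n) ^ (k + 1)) \<longlongrightarrow>
            (- 1) ^ k / fact k * (deriv ^^ k) (\<lambda>z. deriv F z / F z) 0) at_top"
proof -
  \<comment> \<open>The maximum with 1 absorbs \<open>C\<close> into the exponent while keeping it
    nonnegative.\<close>
  define B where "B = ln (max C 1)"
  define A where "A R = B + (2 * R) powr \<rho>" for R :: real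
  define E where "E R = real (k + 1) * (2 * (A R + 1)) / (R / 2) ^ (k + 1)" for R :: real
  have "filterlim (\<lambda>R::real. 2 * R) at_top at_top"
    by real_asymp
  from eventually_compose_filterlim[OF growth this] have ev:
    "\<forall>\<^sub>F R in at_top. \<forall>z. norm z = 2 * R \<longrightarrow> norm (F z) \<le> C * exp ((2 * R) powr \<rho>)" .
  have E_lim: "(E \<longlongrightarrow> 0) at_top"
  proof -
    \<comment> \<open>One factor \<open>R / 2\<close> suffices for the limit; the remaining
      \<open>k\<close> factors only help once \<open>R \<ge> 2\<close>.\<close>
    have "((\<lambda>R. real (k + 1) * (2 * (B + (2 * R) powr \<rho> + 1)) / (R / 2) * (1 / (R / 2) ^ k)) \<longlongrightarrow> 0) at_top"
    proof (rule Lim_null_comparison)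
      show "((\<lambda>R. real (k + 1) * (2 * (B + (2 * R) powr \<rho> + 1)) / (R / 2)) \<longlongrightarrow> 0) at_top"
        using \<rho> by real_asymp
      have "B \<ge> 0" by (simp add: B_def)
      show "\<forall>\<^sub>F R in at_top. norm (real (k + 1) * (2 * (B + (2 * R) powr \<rho> + 1)) / (R / 2) * (1 / (R / 2) ^ k))
              \<le> real (k + 1) * (2 * (B + (2 * R) powr \<rho> + 1)) / (R / 2)"
        using eventually_ge_at_top[of 2]
      proof eventually_elim
        case (elim R)
        have "real (k + 1) * (2 * (B + (2 * R) powr \<rho> + 1)) / (R / 2) * (1 / (R / 2) ^ k)
               \<le> real (k + 1) * (2 * (B + (2 * R) powr \<rho> + 1)) / (R / 2) * 1"
          using elim \<open>B \<ge> 0\<close> by (intro mult_left_mono) (auto simp: divide_simps intro!: power_mono)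
        then show ?case
          using elim \<open>B \<ge> 0\<close> by simp
      qed
    qed
    moreover have "real (k + 1) * (2 * (B + (2 * R) powr \<rho> + 1)) / (R / 2) * (1 / (R / 2) ^ k) = E R" for R
      by (simp add: E_def A_def)
    ultimately show ?thesis by simp
  qed
  have E_bound: "\<forall>\<^sub>F R in at_top. norm ((\<Sum>n | norm (x n) < R. 1 / (- x n) ^ (k + 1)) -
            (- 1) ^ k / fact k * (deriv ^^ k) (\<lambda>z. deriv F z / F z) 0) \<le> E R"
    using ev eventually_gt_at_top[of 0]
  proof eventually_elim
    case (elim R)
    have "norm (F z) \<le> exp (A R)" if "norm z = 2 * R" for z
    proof -
      have "norm (F z) \<le> C * exp ((2 * R) powr \<rho>)" using elim that by blast
      also have "\<dots> \<le> max C 1 * exp ((2 * R) powr \<rho>)"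
        by (intro mult_right_mono) auto
      also have "\<dots> = exp (A R)"
        by (simp add: A_def B_def exp_add)
      finally show ?thesis .
    qed
    moreover have "A R \<ge> 0" by (simp add: A_def B_def)
    ultimately show ?case
      unfolding E_def using log_deriv_partial_sum_bound[OF holo F0 enum elim(2)]
      by (subst norm_minus_commute) blast
  qed
  show ?thesis
    by (rule LIM_zero_cancel[OF Lim_null_comparison[OF E_bound E_lim]])
qed


section \<open>From sums over discs to absolutely convergent series\<close>

text \<open>In the sector no cancellation occurs: the real part of a disc sum dominates \<beta>
  times the sum of moduli. Every initial segment of indices lies in a large disc, whose sum is close
  to \<open>c\<close>.\<close>

lemma summable_norm_of_sector:
  fixes g x :: "nat \<Rightarrow> complex"
  assumes \<beta>: "\<beta> > 0" and sector: "\<And>n. \<beta> * norm (g n) \<le> Re (g n)"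
    and fin: "\<And>R. finite {n. norm (x n) < R}"
    and lim: "((\<lambda>R. \<Sum>n | norm (x n) < R. g n) \<longlongrightarrow> c) at_top"
  shows "summable (\<lambda>n. norm (g n))"
proof (rule summableI_nonneg_bounded)
  fix N
  obtain M where M: "\<forall>n<N. norm (x n) < M"
    using finite_nat_set_iff_bounded[of "{..<N}"]
    by (metis (no_types, lifting) finite_imageI finite_lessThan imageI lessThan_iff
        Max_ge le_less_trans less_add_one)
  have "\<forall>\<^sub>F R in at_top. dist (\<Sum>n | norm (x n) < R. g n) c < 1"
    using lim by (rule tendstoD) simp
  then have "\<forall>\<^sub>F R in at_top. dist (\<Sum>n | norm (x n) < R. g n) c < 1 \<and> R \<ge> M"
    using eventually_ge_at_top by (rule eventually_conj)
  then obtain R where R: "dist (\<Sum>n | norm (x n) < R. g n) c < 1" "R \<ge> M"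
    using eventually_happens'[OF trivial_limit_at_top_linorder] by blast
  have "\<beta> * (\<Sum>n<N. norm (g n)) \<le> \<beta> * (\<Sum>n | norm (x n) < R. norm (g n))"
    using M R \<beta> fin by (intro mult_left_mono sum_mono2) force+
  also have "\<dots> \<le> Re (\<Sum>n | norm (x n) < R. g n)"
    using sector by (auto simp: sum_distrib_left intro: sum_mono)
  also have "\<dots> \<le> norm (\<Sum>n | norm (x n) < R. g n)"
    by (rule complex_Re_le_cmod)
  also have "\<dots> \<le> norm c + 1"
    using R(1) norm_triangle_ineq2[of "\<Sum>n | norm (x n) < R. g n" c] by (simp add: dist_norm)
  finally show "(\<Sum>n<N. norm (g n)) \<le> (norm c + 1) / \<beta>"
    using \<beta> by (simp add: field_simps)
qed simp

text \<open>The discs eventually contain every finite index set, so the disc sums follow the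
  unordered sum, which absolute convergence identifies with the series.\<close>

lemma sums_of_exhausting_partial_sums:
  fixes g x :: "nat \<Rightarrow> complex"
  assumes summable: "summable (\<lambda>n. norm (g n))"
    and fin: "\<And>R. finite {n. norm (x n) < R}"
    and lim: "((\<lambda>R. \<Sum>n | norm (x n) < R. g n) \<longlongrightarrow> c) at_top"
  shows "g sums c"
proof -
  have "filterlim (\<lambda>R. {n. norm (x n) < R}) (finite_subsets_at_top UNIV) at_top"
    unfolding filterlim_finite_subsets_at_top
  proof safe
    fix X :: "nat set" assume X: "finite X"
    have "\<forall>\<^sub>F R in at_top. \<forall>n\<in>X. norm (x n) < R"
      using X by (simp add: eventually_ball_finite_distrib eventually_gt_at_top)
    then show "\<forall>\<^sub>F R in at_top. finite {n. norm (x n) < R} \<and> X \<subseteq> {n. norm (x n) < R} \<and> {n. norm (x n) < R} \<subseteq> UNIV"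
      by eventually_elim (use fin in auto)
  qed
  moreover have "(g has_sum suminf g) UNIV"
    using summable summable_sums[OF summable_norm_cancel[OF summable]]
    by (rule norm_summable_imp_has_sum)
  ultimately have "((\<lambda>R. \<Sum>n | norm (x n) < R. g n) \<longlongrightarrow> suminf g) at_top"
    unfolding has_sum_def by (rule filterlim_compose[rotated])
  then have "suminf g = c"
    using lim by (rule tendsto_unique[OF trivial_limit_at_top_linorder])
  then show ?thesis
    using summable_sums[OF summable_norm_cancel[OF summable]] by simp
qed

section \<open>Differences, bounded power sums and reality\<close>

text \<open>Each negated difference multiplies the terms by \<open>1 - t j\<close>, since
  \<open>t j ^ n - t j ^ Suc n = t j ^ n * (1 - t j)\<close>.\<close>

lemma funpow_forward_diff_sums:
  fixes t :: "nat \<Rightarrow> 'a::real_normed_field"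
  assumes "\<And>k. (\<lambda>j. d j * t j ^ k) sums m k"
  shows "(\<lambda>j. d j * t j ^ n * (1 - t j) ^ k) sums ((- 1) ^ k * (forward_diff ^^ k) m n)"
proof (induction k arbitrary: n)
  case (Suc k)
  from sums_diff[OF Suc.IH[of n] Suc.IH[of "Suc n"]] show ?case
    by (simp add: forward_diff_def algebra_simps)
qed (use assms in simp)

text \<open>For \<open>q \<noteq> 1\<close> the geometric sums stay below
  \<open>2 / norm (1 - q)\<close>, so dividing by \<open>N\<close> sends them to 0.\<close>

lemma cesaro_mean_powers_tendsto:
  fixes q :: complex
  assumes "norm q \<le> 1"
  shows "(\<lambda>N. (\<Sum>i<N. q ^ i) / of_nat N) \<longlonglongrightarrow> (if q = 1 then 1 else 0)"
proof (cases "q = 1")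
  case True
  have "\<forall>\<^sub>F N in sequentially. (\<Sum>i<N. q ^ i) / of_nat N = 1"
    using eventually_gt_at_top[of 0] by eventually_elim (use True in auto)
  then show ?thesis
    using True by (simp add: tendsto_eventually)
next
  case False
  have "(\<lambda>N. (\<Sum>i<N. q ^ i) / of_nat N) \<longlonglongrightarrow> 0"
  proof (rule Lim_null_comparison)
    show "\<forall>\<^sub>F N in sequentially. norm ((\<Sum>i<N. q ^ i) / of_nat N) \<le> (2 / norm (1 - q)) * (1 / of_nat N)"
    proof (intro always_eventually allI)
      fix N
      have "norm (1 - q ^ N) \<le> 1 + norm q ^ N"
        using norm_triangle_ineq4[of 1 "q ^ N"] by (simp add: norm_power)
      also have "\<dots> \<le> 2"
        using assms by (simp add: power_le_one)
      finally show "norm ((\<Sum>i<N. q ^ i) / of_nat N) \<le> (2 / norm (1 - q)) * (1 / of_nat N)"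
        using False by (auto simp: sum_gp_strict norm_divide norm_mult intro: divide_right_mono)
    qed
    show "(\<lambda>N. (2 / norm (1 - q)) * (1 / of_nat N)) \<longlonglongrightarrow> 0"
      by (intro tendsto_mult_right_zero lim_1_over_n)
  qed
  then show ?thesis using False by simp
qed

text \<open>If some \<open>z k\<close> lay outside the unit disc, convergence to \<open>w\<close>
  would leave finitely many candidates for the largest modulus, attained at some \<open>z l\<close>.
  After division by powers of \<open>z l\<close> the sums decay, yet their Cesaro means tend to the
  nonzero total weight at the value \<open>z l\<close>.\<close>

lemma norm_le_1_of_bounded_power_sums:
  fixes d z :: "nat \<Rightarrow> complex"
  assumes summable: "summable (\<lambda>j. norm (d j))"
    and z_lim: "z \<longlonglongrightarrow> w" "norm w \<le> 1"
    and bounded: "\<And>N. norm (\<Sum>j. d j * z j ^ N) \<le> C"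
    and nonzero: "\<And>k. norm (z k) > 1 \<Longrightarrow> (\<Sum>j | z j = z k. d j) \<noteq> 0"
  shows "norm (z k) \<le> 1"
proof (rule ccontr)
  assume "\<not> norm (z k) \<le> 1"
  then have k: "norm (z k) > 1" by simp
  have fin: "finite {j. norm (z j) \<ge> r}" if "r > 1" for r
  proof -
    have "\<forall>\<^sub>F j in sequentially. norm (z j) < r"
      using tendsto_norm[OF z_lim(1)] by (rule order_tendstoD) (use that z_lim(2) in simp)
    then have "\<forall>\<^sub>F j in cofinite. norm (z j) < r"
      by (simp add: cofinite_eq_sequentially)
    then show ?thesis
      by (simp add: eventually_cofinite not_less)
  qed
  define K where "K = {j. norm (z j) \<ge> norm (z k)}"
  have "finite K" "k \<in> K" "K \<noteq> {}" using fin[OF k] by (auto simp: K_def)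
  obtain l where "l \<in> K" "Max ((\<lambda>j. norm (z j)) ` K) = norm (z l)"
    by (rule obtains_MAX[OF \<open>finite K\<close> \<open>K \<noteq> {}\<close>])
  then have l: "l \<in> K" "\<And>j. j \<in> K \<Longrightarrow> norm (z j) \<le> norm (z l)"
    using Max_ge[of "(\<lambda>j. norm (z j)) ` K"] \<open>finite K\<close> by auto
  have max: "norm (z j) \<le> norm (z l)" for j
    using l(2)[of j] l(2)[OF \<open>k \<in> K\<close>] unfolding K_def by fastforce
  have l1: "norm (z l) > 1" using k l(1) by (simp add: K_def)
  then have inv_less: "1 / norm (z l) < 1"
    by (subst pos_divide_less_eq) linarith+
  define q where "q j = z j / z l" for j
  have q_le: "norm (q j) \<le> 1" for j
    using max[of j] l1 by (simp add: q_def norm_divide divide_le_eq_1)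
  have q_1: "q j = 1 \<longleftrightarrow> z j = z l" for j
    using l1 by (auto simp: q_def)
  have summ: "summable (\<lambda>j. d j * q j ^ n)" for n
    by (rule summable_comparison_test'[OF summable, of 0])
       (use q_le in \<open>auto simp: norm_mult norm_power intro!: mult_left_le power_le_one\<close>)
  have term_le: "norm (\<Sum>j. d j * q j ^ n) \<le> C * (1 / norm (z l)) ^ n" for n
  proof -
    have "z l \<noteq> 0" using l1 by auto
    then have "d j * q j ^ n * z l ^ n = d j * z j ^ n" for j
      by (simp add: q_def power_divide)
    then have "(\<Sum>j. d j * q j ^ n) * z l ^ n = (\<Sum>j. d j * z j ^ n)"
      by (simp only: suminf_mult2[OF summ])
    then have "norm (\<Sum>j. d j * q j ^ n) * norm (z l) ^ n \<le> C"
      using bounded[of n] by (metis norm_mult norm_power)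
    moreover have "norm (z l) ^ n > 0" using l1 by (intro zero_less_power) linarith
    ultimately show ?thesis
      by (simp add: power_one_over pos_le_divide_eq)
  qed
  have C: "C \<ge> 0" using bounded[of 0] norm_ge_zero order_trans by blast
  text \<open>Cesaro means isolate the terms with \<open>q j = 1\<close>, while the geometric decay in \<open>term_le\<close> makes them
    tend to \<open>0\<close>.\<close>
  have "(\<lambda>N. \<Sum>j. d j * ((\<Sum>i<N. q j ^ i) / of_nat N)) \<longlonglongrightarrow> 0"
  proof (rule Lim_null_comparison)
    show "(\<lambda>N. C / (1 - 1 / norm (z l)) * (1 / of_nat N)) \<longlonglongrightarrow> 0"
      by (intro tendsto_mult_right_zero lim_1_over_n)
    have "norm (\<Sum>j. d j * ((\<Sum>i<N. q j ^ i) / of_nat N)) \<le> C / (1 - 1 / norm (z l)) * (1 / of_nat N)" for N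
    proof -
      have "(\<Sum>j. d j * ((\<Sum>i<N. q j ^ i) / of_nat N)) = (\<Sum>j. (\<Sum>i<N. d j * q j ^ i) / of_nat N)"
        by (simp add: sum_distrib_left)
      also have "\<dots> = (\<Sum>j. (\<Sum>i<N. d j * q j ^ i)) / of_nat N"
        using summ by (intro suminf_divide summable_sum)
      also have "(\<Sum>j. (\<Sum>i<N. d j * q j ^ i)) = (\<Sum>i<N. \<Sum>j. d j * q j ^ i)"
        using summ by (rule suminf_sum)
      also have "norm (\<dots> / of_nat N) \<le> (\<Sum>i<N. C * (1 / norm (z l)) ^ i) / of_nat N"
        unfolding norm_divide norm_of_nat
        using term_le by (intro divide_right_mono sum_norm_le) auto
      also have "(\<Sum>i<N. C * (1 / norm (z l)) ^ i) \<le> (\<Sum>i. C * (1 / norm (z l)) ^ i)"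
        using inv_less C by (intro sum_le_suminf summable_mult summable_geometric) auto
      also have "\<dots> = C / (1 - 1 / norm (z l))"
        using inv_less by (subst suminf_mult) (auto simp: suminf_geometric intro!: summable_geometric)
      finally show ?thesis
        by (simp add: divide_right_mono)
    qed
    then show "\<forall>\<^sub>F N in sequentially. norm (\<Sum>j. d j * ((\<Sum>i<N. q j ^ i) / of_nat N))
                 \<le> C / (1 - 1 / norm (z l)) * (1 / of_nat N)"
      by simp
  qed
  \<comment> \<open>Tannery's theorem with majorant \<open>norm (d j)\<close> moves the limit inside
    the series.\<close>
  moreover have "(\<lambda>N. \<Sum>j. d j * ((\<Sum>i<N. q j ^ i) / of_nat N)) \<longlonglongrightarrow> (\<Sum>j. d j * (if q j = 1 then 1 else 0))"
  proof -
    have "norm (d j * ((\<Sum>i<N. q j ^ i) / of_nat N)) \<le> norm (d j)" for j N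
    proof -
      have "norm (\<Sum>i<N. q j ^ i) \<le> of_nat (card {..<N}) * 1"
        using q_le by (intro sum_norm_bound) (simp add: norm_power power_le_one)
      then have "norm ((\<Sum>i<N. q j ^ i) / of_nat N) \<le> 1"
        by (auto simp: norm_divide divide_le_eq_1)
      then show ?thesis
        unfolding norm_mult by (intro mult_left_le) auto
    qed
    then have "\<forall>\<^sub>F (j, N) in at_top \<times>\<^sub>F sequentially.
        norm (d j * ((\<Sum>i<N. q j ^ i) / of_nat N)) \<le> norm (d j)"
      by (intro always_eventually) auto
    moreover have "(\<lambda>N. d j * ((\<Sum>i<N. q j ^ i) / of_nat N)) \<longlonglongrightarrow> d j * (if q j = 1 then 1 else 0)" for j
      using q_le by (intro tendsto_mult_left cesaro_mean_powers_tendsto)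
    ultimately show ?thesis
      using summable by (intro conjunct2[OF conjunct2[OF tannerys_theorem]]) auto
  qed
  ultimately have "(\<Sum>j. d j * (if q j = 1 then 1 else 0)) = 0"
    using LIMSEQ_unique by blast
  moreover have "(\<Sum>j. d j * (if q j = 1 then 1 else 0)) = (\<Sum>j | z j = z l. d j)"
  proof -
    have "finite {j. z j = z l}"
      by (rule finite_subset[OF _ fin[OF l1]]) auto
    then show ?thesis
      using suminf_finite[of "{j. z j = z l}" "\<lambda>j. d j * (if q j = 1 then 1 else 0)"]
      by (auto simp: q_1 intro!: sum.cong)
  qed
  ultimately show False
    using nonzero[OF l1] by simp
qed

text \<open>The points \<open>1 - t + t * \<zeta>\<close> trace a circle through 1 with centre
  \<open>1 - t\<close>. Staying in the unit disc forces tangency at 1, hence a real centre.\<close>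

lemma Im_eq_0_of_norm_le_1:
  fixes t :: complex
  assumes le: "\<And>\<zeta>. norm \<zeta> = 1 \<Longrightarrow> norm (1 - t + t * \<zeta>) \<le> 1"
  shows "Im t = 0"
proof (rule ccontr)
  assume y: "Im t \<noteq> 0"
  define K where "K = Re t - (Re t)\<^sup>2 - (Im t)\<^sup>2"
  have *: "- s * Im t \<le> s\<^sup>2 * K" for s :: real
  proof -
    have ne: "Complex 1 (- s) \<noteq> 0" by (simp add: complex_eq_iff)
    define \<zeta> where "\<zeta> = Complex 1 s / Complex 1 (- s)"
    have "norm (Complex 1 s) = norm (Complex 1 (- s))"
      by (simp add: cmod_def)
    then have "norm \<zeta> = 1"
      using ne by (simp add: \<zeta>_def norm_divide)
    moreover have "1 - t + t * \<zeta> = Complex (1 - 2 * s * Im t) (s * (2 * Re t - 1)) / Complex 1 (- s)"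
    proof -
      have "1 - t + t * \<zeta> = (Complex 1 (- s) + t * (Complex 1 s - Complex 1 (- s))) / Complex 1 (- s)"
        using ne by (simp add: \<zeta>_def field_simps)
      also have "Complex 1 (- s) + t * (Complex 1 s - Complex 1 (- s))
                   = Complex (1 - 2 * s * Im t) (s * (2 * Re t - 1))"
        by (simp add: complex_eq_iff algebra_simps)
      finally show ?thesis .
    qed
    ultimately have "norm (Complex (1 - 2 * s * Im t) (s * (2 * Re t - 1))) \<le> norm (Complex 1 (- s))"
      using le[of \<zeta>] ne by (simp add: norm_divide divide_le_eq_1)
    then have "(1 - 2 * s * Im t)\<^sup>2 + (s * (2 * Re t - 1))\<^sup>2 \<le> 1 + s\<^sup>2"
      by (simp add: cmod_def)
    then show ?thesis
      by (simp add: K_def power2_eq_square algebra_simps)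
  qed
  \<comment> \<open>The choice ensures \<open>e * K < 1\<close>, while \<open>s = - e * Im t\<close>
    in the inequality would give \<open>1 \<le> e * K\<close>.\<close>
  define e where "e = 1 / (\<bar>K\<bar> + 1)"
  have e: "e > 0" by (simp add: e_def)
  have "e * (Im t)\<^sup>2 \<le> (e * (Im t)\<^sup>2) * (e * K)"
    using *[of "- e * Im t"] by (simp add: power2_eq_square algebra_simps)
  then have "1 \<le> e * K"
    using e y by (metis mult_le_cancel_left1 mult_pos_pos zero_less_power2 not_less)
  moreover have "e * K < 1"
  proof -
    have "K < \<bar>K\<bar> + 1" "0 < \<bar>K\<bar> + 1" by auto
    then show ?thesis by (simp add: e_def)
  qed
  ultimately show False by simp
qed

lemma real_of_nonneg_moments:
  fixes t :: "nat \<Rightarrow> complex" and c :: "nat \<Rightarrow> nat \<Rightarrow> complex"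
  assumes t: "\<And>j. t j \<noteq> 0" "t \<longlonglongrightarrow> 0" and summable: "summable (\<lambda>j. norm (t j ^ 2))"
    and sums: "\<And>n k. (\<lambda>j. t j ^ (n + 2) * (1 - t j) ^ k) sums c n k"
    and nonneg: "\<And>n k. c n k \<in> \<real>\<^sub>\<ge>\<^sub>0"
  shows "Im (t j) = 0"
proof (rule Im_eq_0_of_norm_le_1)
  fix \<zeta> :: complex assume \<zeta>: "norm \<zeta> = 1"
  have expand: "(\<lambda>j. t j ^ 2 * (1 - t j + t j * \<zeta>) ^ N) sums
      (\<Sum>k\<le>N. of_nat (N choose k) * \<zeta> ^ k * c k (N - k))" for N \<zeta>
  proof -
    have "t j ^ 2 * (1 - t j + t j * \<zeta>) ^ N
            = (\<Sum>k\<le>N. of_nat (N choose k) * \<zeta> ^ k * (t j ^ (k + 2) * (1 - t j) ^ (N - k)))" for j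
    proof -
      have "(1 - t j + t j * \<zeta>) ^ N = (t j * \<zeta> + (1 - t j)) ^ N"
        by (simp add: add.commute)
      also have "\<dots> = (\<Sum>k\<le>N. of_nat (N choose k) * (t j * \<zeta>) ^ k * (1 - t j) ^ (N - k))"
        by (rule binomial_ring)
      finally have *: "(1 - t j + t j * \<zeta>) ^ N
          = (\<Sum>k\<le>N. of_nat (N choose k) * (t j * \<zeta>) ^ k * (1 - t j) ^ (N - k))" .
      show ?thesis
        unfolding * sum_distrib_left
        by (intro sum.cong refl) (simp add: power_mult_distrib power_add power2_eq_square mult_ac)
    qed
    then show ?thesis
      using sums by (auto intro!: sums_sum sums_mult)
  qed
  have "norm (\<Sum>j. t j ^ 2 * (1 - t j + t j * \<zeta>) ^ N) \<le> Re (\<Sum>j. t j ^ 2)" for N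
  proof -
    have "norm (\<Sum>j. t j ^ 2 * (1 - t j + t j * \<zeta>) ^ N)
            = norm (\<Sum>k\<le>N. of_nat (N choose k) * \<zeta> ^ k * c k (N - k))"
      using sums_unique[OF expand[of \<zeta> N]] by simp
    \<comment> \<open>Moduli remove \<zeta>; as the \<open>c k (N - k)\<close> are nonnegative
      reals, what remains is the same expansion at 1, where each base \<open>1 - t j + t j\<close>
      is 1.\<close>
    also have "\<dots> \<le> (\<Sum>k\<le>N. of_nat (N choose k) * norm (c k (N - k)))"
      using \<zeta> by (intro sum_norm_le) (simp add: norm_mult norm_power)
    also have "\<dots> = Re (\<Sum>k\<le>N. of_nat (N choose k) * 1 ^ k * c k (N - k))"
      using nonneg by (auto simp: complex_nonneg_Reals_iff cmod_def)
    also have "\<dots> = Re (\<Sum>j. t j ^ 2)"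
      using sums_unique[OF expand[of 1 N]] by simp
    finally show ?thesis .
  qed
  moreover have "(\<lambda>j. 1 - t j + t j * \<zeta>) \<longlonglongrightarrow> 1"
    using t(2) by (auto intro!: tendsto_eq_intros)
  \<comment> \<open>For \<zeta> different from 1, equal bases mean equal \<open>t i\<close>, so the
    total weight is a positive multiple of \<open>t k ^ 2\<close>.\<close>
  moreover have "(\<Sum>i | 1 - t i + t i * \<zeta> = 1 - t k + t k * \<zeta>. t i ^ 2) \<noteq> 0"
    if "norm (1 - t k + t k * \<zeta>) > 1" for k
  proof -
    have "\<zeta> \<noteq> 1" using that by auto
    have "1 - t i + t i * \<zeta> = 1 - t k + t k * \<zeta> \<longleftrightarrow> (t i - t k) * (\<zeta> - 1) = 0" for i
      by (simp add: algebra_simps)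
    then have eq: "1 - t i + t i * \<zeta> = 1 - t k + t k * \<zeta> \<longleftrightarrow> t i = t k" for i
      using \<open>\<zeta> \<noteq> 1\<close> by simp
    have "\<forall>\<^sub>F i in cofinite. t i \<noteq> t k"
      using tendsto_imp_eventually_ne[OF t(2), of "t k"] t(1)[of k]
      by (simp add: cofinite_eq_sequentially)
    then have "finite {i. t i = t k}"
      by (simp add: eventually_cofinite)
    moreover have "k \<in> {i. t i = t k}" by simp
    ultimately have "card {i. t i = t k} \<noteq> 0" by auto
    moreover have "(\<Sum>i | t i = t k. t i ^ 2) = of_nat (card {i. t i = t k}) * t k ^ 2"
      by simp
    ultimately show ?thesis
      unfolding eq using t(1)[of k] by simp
  qed
  ultimately show "norm (1 - t j + t j * \<zeta>) \<le> 1"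
    using summable by (intro norm_le_1_of_bounded_power_sums[where d = "\<lambda>j. t j ^ 2"
      and z = "\<lambda>j. 1 - t j + t j * \<zeta>" and w = 1]) auto
qed


section \<open>Growth from the order, and assembly\<close>

lemma entire_order_less_1_growth:
  assumes "continuous_on UNIV f" and order: "entire_order f < 1"
  obtains \<rho> where "0 < \<rho>" "\<rho> < 1"
    "\<forall>\<^sub>F r in at_top. \<forall>z. norm z = r \<longrightarrow> norm (f z) \<le> exp (r powr \<rho>)"
proof -
  \<comment> \<open>The maximum with 0 forces \<rho> to be positive.\<close>
  have "max (entire_order f) 0 < 1"
    using order by simp
  then obtain \<rho> where \<rho>: "max (entire_order f) 0 < ereal \<rho>" "ereal \<rho> < 1"
    using ereal_dense2 by blast
  have "\<forall>\<^sub>F r in at_top. ereal (ln (ln (max_modulus f r)) / ln r) < ereal \<rho>"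
    using \<rho>(1) unfolding entire_order_def by (intro Limsup_lessD) simp
  then have "\<forall>\<^sub>F r in at_top. \<forall>z. norm z = r \<longrightarrow> norm (f z) \<le> exp (r powr \<rho>)"
    using eventually_gt_at_top[of 1]
  proof eventually_elim
    case (elim r)
    have le: "norm (f z) \<le> max_modulus f r" if "norm z = r" for z
      unfolding max_modulus_def
    proof (rule cSUP_upper)
      have "compact ((\<lambda>z. norm (f z)) ` sphere 0 r)"
        using assms(1) by (intro compact_continuous_image continuous_on_norm)
          (auto intro: continuous_on_subset)
      then show "bdd_above ((\<lambda>z. norm (f z)) ` sphere 0 r)"
        by (intro bounded_imp_bdd_above compact_imp_bounded)
    qed (use that in simp)
    \<comment> \<open>If the modulus is at most 1, the iterated logarithm carries no information,
      but the bound is trivial.\<close>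
    have "max_modulus f r \<le> exp (r powr \<rho>)"
    proof (cases "max_modulus f r \<le> 1")
      case True
      also have "1 \<le> exp (r powr \<rho>)" by simp
      finally show ?thesis .
    next
      case False
      have "ln (ln (max_modulus f r)) < \<rho> * ln r"
        using elim by (simp add: pos_divide_less_eq)
      then have "exp (ln (ln (max_modulus f r))) < exp (\<rho> * ln r)"
        by simp
      then have "ln (max_modulus f r) < exp (\<rho> * ln r)"
        using False by simp
      also have "\<dots> = r powr \<rho>"
        using elim by (simp add: powr_def)
      finally have "exp (ln (max_modulus f r)) \<le> exp (r powr \<rho>)"
        by simp
      then show ?thesis
        using False by simp
    qed
    then show ?case using le order_trans by blast
  qed
  then show ?thesis
    using \<rho> that[of \<rho>] by auto
qed

text \<open>\<open>remove_sings\<close> repairs the default value of the quotient at 0. As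
  \<open>m\<close> is complex-valued, membership in \<open>\<real>\<^sub>\<ge>\<^sub>0\<close>
  expresses both reality and sign. Both series formulas are proved, not assumed.\<close>

theorem corollary3:
  fixes f F :: "complex \<Rightarrow> complex" and a :: "nat \<Rightarrow> real" and \<mu> :: nat
    and lam m :: "nat \<Rightarrow> complex" and \<beta>\<^sub>0 :: real
  assumes entire: "f holomorphic_on UNIV"
    and order: "entire_order f < 1"
    and expansion: "\<And>z. z \<noteq> 0 \<Longrightarrow> (\<lambda>n. of_real (a n) * z ^ n) sums (f z / z ^ \<mu>)"
    and coeffs: "\<And>n. n \<ge> 1 \<Longrightarrow> a 0 * a n > 0"
    and zeros: "enumerates_nonzero_zeros f (\<lambda>n. - lam n)"
    and beta: "0 < \<beta>\<^sub>0" "\<beta>\<^sub>0 < 1"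
    and sector: "\<And>n. Re (lam n) \<ge> \<beta>\<^sub>0 * norm (lam n)"
    and Re_gt_1: "(INF n. Re (lam n)) > 1"
    and F_def: "F = remove_sings (\<lambda>z. f z / (of_real (a 0) * z ^ \<mu>))"
    and m_def: "\<And>k. m k = (- 1) ^ (k + 1) / fact (k + 1) *
                          (deriv ^^ (k + 1)) (\<lambda>z. deriv F z / F z) 0"
  shows "(\<forall>k. (\<lambda>j. 1 / lam j ^ (k + 2)) sums m k) \<and>
         (\<forall>n k. (\<lambda>j. 1 / lam j ^ (n + 2) * (1 - 1 / lam j) ^ k) sums
                 ((- 1) ^ k * (forward_diff ^^ k) m n)) \<and>
         ((\<forall>n k. (- 1) ^ k * (forward_diff ^^ k) m n \<in> \<real>\<^sub>\<ge>\<^sub>0) \<longrightarrow>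
           (\<forall>z. z \<noteq> 0 \<and> f z = 0 \<longrightarrow> z \<in> \<real> \<and> Re z < 0))"
proof -
  have a0: "a 0 \<noteq> 0"
    using coeffs[of 1] by auto
  \<comment> \<open>The power series supplies the entire extension of the quotient across 0.\<close>
  define p where "p z = (\<Sum>n. of_real (a n / a 0) * z ^ n :: complex)" for z
  have scaled: "(\<lambda>n. of_real (a n / a 0) * z ^ n) sums (f z / (of_real (a 0) * z ^ \<mu>))"
    if "z \<noteq> 0" for z
    using sums_divide[OF expansion[OF that], of "of_real (a 0)"]
    by (simp add: mult.commute[of "of_real (a 0)"])
  have p_sums: "(\<lambda>n. of_real (a n / a 0) * z ^ n) sums p z" for z :: complex
  proof -
    have "summable (\<lambda>n. of_real (a n / a 0) * z ^ n)"
    proof (cases "z = 0")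
      case True
      show ?thesis
        unfolding True by (rule sums_summable[OF powser_sums_zero])
    qed (rule sums_summable[OF scaled])
    then show ?thesis
      unfolding p_def by (rule summable_sums)
  qed
  have p_eq: "p z = f z / (of_real (a 0) * z ^ \<mu>)" if "z \<noteq> 0" for z
    using sums_unique2[OF p_sums scaled[OF that]] .
  have p_holo: "p holomorphic_on UNIV"
  proof -
    have "p holomorphic_on ball 0 r" for r
      by (rule power_series_holomorphic[of 0 r "\<lambda>n. of_real (a n / a 0)"]) (use p_sums in simp)
    then have "p analytic_on {z}" for z
      by (intro holomorphic_on_imp_analytic_at[of p "ball 0 (norm z + 1)"]) auto
    then show ?thesis
      by (metis analytic_imp_holomorphic analytic_on_analytic_at)
  qed
  have F_eq_p: "F = p"
  proof
    fix z
    have "F z = remove_sings p z"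
      unfolding F_def
    proof (rule remove_sings_cong)
      have "\<forall>\<^sub>F w in at z. w \<noteq> 0"
        by (rule eventually_neq_at_within)
      then show "\<forall>\<^sub>F w in at z. f w / (of_real (a 0) * w ^ \<mu>) = p w"
        by eventually_elim (simp add: p_eq)
    qed auto
    also have "\<dots> = p z"
      using p_holo by (intro remove_sings_at_analytic) (auto simp: analytic_on_holomorphic)
    finally show "F z = p z" .
  qed
  have F_holo: "F holomorphic_on UNIV" and F_eq: "\<And>z. z \<noteq> 0 \<Longrightarrow> F z = f z / (of_real (a 0) * z ^ \<mu>)"
    using p_holo p_eq by (simp_all add: F_eq_p)
  have F0: "F 0 = 1"
    using sums_unique2[OF p_sums[of 0] powser_sums_zero] a0 by (simp add: F_eq_p)
  have F_zero_iff: "F z = 0 \<longleftrightarrow> f z = 0" if "z \<noteq> 0" for z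
    using that a0 F_eq by simp
  have F_nonzero: "\<forall>\<^sub>F w in at z. F w \<noteq> 0" for z
    using non_zero_neighbour_alt[OF F_holo, of z 0] F0 connected_UNIV by auto
  \<comment> \<open>Away from 0 the factor \<open>of_real (a 0) * z ^ \<mu>\<close> is analytic and
    nonzero, so it does not change orders.\<close>
  have zorder_eq: "zorder F z = zorder f z" if "z \<noteq> 0" for z
  proof -
    have ev: "\<forall>\<^sub>F w in at z. w \<noteq> 0"
      by (rule eventually_neq_at_within)
    have "zorder f z = zorder (\<lambda>w. F w * (of_real (a 0) * w ^ \<mu>)) z"
    proof (rule zorder_cong)
      show "\<forall>\<^sub>F w in at z. f w = F w * (of_real (a 0) * w ^ \<mu>)"
        using ev by eventually_elim (use a0 F_eq in simp)
    qed simp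
    also have "\<dots> = zorder F z + zorder (\<lambda>w. of_real (a 0) * w ^ \<mu>) z"
    proof (rule zorder_times_analytic)
      show "F analytic_on {z}"
        using F_holo by (auto simp: analytic_on_holomorphic)
      show "\<forall>\<^sub>F w in at z. F w * (of_real (a 0) * w ^ \<mu>) \<noteq> 0"
        using F_nonzero[of z] ev by eventually_elim (use a0 in simp)
    qed (auto intro!: analytic_intros)
    also have "zorder (\<lambda>w. of_real (a 0) * w ^ \<mu> :: complex) z = 0"
      using that a0 by (intro zorder_eq_0I analytic_intros) auto
    finally show ?thesis by simp
  qed
  have F_enum: "enumerates_nonzero_zeros F (\<lambda>n. - lam n)"
    using zeros F_zero_iff zorder_eq unfolding enumerates_nonzero_zeros_def by metis

  have fin: "finite {n. norm (- lam n) < R}" for R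
    using finite_zeros_in_ball[OF F_holo _ F_enum] F0 by simp
  \<comment> \<open>An infimum of reals bounds the terms only if they are bounded below, which the
    sector condition ensures.\<close>
  have lam_Re: "Re (lam n) > 1" for n
  proof -
    have "Re (lam j) \<ge> 0" for j
      using beta by (intro order_trans[OF _ sector[of j]]) simp
    then have "bdd_below (range (\<lambda>n. Re (lam n)))"
      by (intro bdd_belowI[of _ 0]) auto
    then have "(INF n. Re (lam n)) \<le> Re (lam n)"
      by (rule cINF_lower) simp
    then show ?thesis using Re_gt_1 by simp
  qed
  have lam: "norm (lam n) > 1" "lam n \<noteq> 0" for n
    using lam_Re[of n] complex_Re_le_cmod[of "lam n"] by auto

  obtain \<rho> where \<rho>: "0 < \<rho>" "\<rho> < 1"
    and growth_f: "\<forall>\<^sub>F r in at_top. \<forall>z. norm z = r \<longrightarrow> norm (f z) \<le> exp (r powr \<rho>)"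
    using entire_order_less_1_growth[OF holomorphic_on_imp_continuous_on[OF entire] order] by blast
  have growth: "\<forall>\<^sub>F r in at_top. \<forall>z. norm z = r \<longrightarrow> norm (F z) \<le> 1 / \<bar>a 0\<bar> * exp (r powr \<rho>)"
    using growth_f eventually_ge_at_top[of 1]
  proof eventually_elim
    case (elim r)
    show ?case
    proof (intro allI impI)
      fix z :: complex assume z: "norm z = r"
      then have "norm (F z) = norm (f z) / (\<bar>a 0\<bar> * r ^ \<mu>)"
        using elim by (subst F_eq) (auto simp: norm_divide norm_mult norm_power)
      also have "\<dots> \<le> exp (r powr \<rho>) / (\<bar>a 0\<bar> * 1)"
        using elim z a0 by (intro frac_le mult_left_mono one_le_power) auto
      finally show "norm (F z) \<le> 1 / \<bar>a 0\<bar> * exp (r powr \<rho>)" by simp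
    qed
  qed
  note lim = log_deriv_partial_sum_tendsto[OF F_holo F0 F_enum \<rho> growth, unfolded minus_minus]

  \<comment> \<open>Inversion preserves the sector, so the case \<open>k = 0\<close> of
    \<open>lim\<close> yields absolute convergence of the first powers.\<close>
  have summable: "summable (\<lambda>n. norm (1 / lam n))"
  proof (rule summable_norm_of_sector[OF beta(1) _ fin])
    show "\<beta>\<^sub>0 * norm (1 / lam n) \<le> Re (1 / lam n)" for n
    proof -
      have "\<beta>\<^sub>0 * norm (1 / lam n) = \<beta>\<^sub>0 * norm (lam n) / (norm (lam n))\<^sup>2"
        using lam(2)[of n] by (simp add: norm_divide power2_eq_square)
      also have "\<dots> \<le> Re (lam n) / (norm (lam n))\<^sup>2"
        using sector by (intro divide_right_mono) auto
      also have "\<dots> = Re (1 / lam n)"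
        by (simp add: Re_divide cmod_power2)
      finally show ?thesis .
    qed
    show "((\<lambda>R. \<Sum>n | norm (- lam n) < R. 1 / lam n) \<longlongrightarrow> deriv F 0 / F 0) at_top"
      using lim[of 0] by simp
  qed
  have summable_power: "summable (\<lambda>n. norm (1 / lam n ^ (k + 2)))" for k
  proof (rule summable_comparison_test'[OF summable, of 0])
    fix n
    have "norm (lam n) ^ 1 \<le> norm (lam n) ^ (k + 2)"
      using lam(1)[of n] by (intro power_increasing) auto
    then show "norm (norm (1 / lam n ^ (k + 2))) \<le> norm (1 / lam n)"
      using lam(2)[of n] by (simp add: norm_divide norm_power frac_le del: power_Suc)
  qed
  \<comment> \<open>Index \<open>k\<close> of \<open>lim\<close> belongs to the power
    \<open>k + 1\<close>, hence the shift.\<close>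
  have m_sums: "(\<lambda>j. 1 / lam j ^ (k + 2)) sums m k" for k
    using lim[of "k + 1"] m_def[of k]
    by (intro sums_of_exhausting_partial_sums[OF summable_power fin]) (simp add: add.assoc)
  have diff_sums: "(\<lambda>j. 1 / lam j ^ (n + 2) * (1 - 1 / lam j) ^ k) sums
                     ((- 1) ^ k * (forward_diff ^^ k) m n)" for n k
    using funpow_forward_diff_sums[of "\<lambda>j. 1 / lam j ^ 2" "\<lambda>j. 1 / lam j" m n k] m_sums
    by (simp add: power_one_over power_add power2_eq_square mult_ac)

  have "z \<in> \<real> \<and> Re z < 0"
    if nonneg: "\<forall>n k. (- 1) ^ k * (forward_diff ^^ k) m n \<in> \<real>\<^sub>\<ge>\<^sub>0" and z: "z \<noteq> 0" "f z = 0" for z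
  proof -
    have "F z = 0" using F_zero_iff z by simp
    then obtain n where n: "z = - lam n"
      using enumerated_zero[OF F_holo _ F_enum] F0 by (metis zero_neq_one)
    have "Im (1 / lam n) = 0"
    proof (rule real_of_nonneg_moments)
      show "1 / lam j \<noteq> 0" for j using lam(2) by simp
      show "(\<lambda>j. 1 / lam j) \<longlonglongrightarrow> 0"
        by (rule summable_LIMSEQ_zero[OF summable_norm_cancel[OF summable]])
      show "summable (\<lambda>j. norm ((1 / lam j) ^ 2))"
        using summable_power[of 0] by (simp add: power_one_over numeral_2_eq_2)
      show "(\<lambda>j. (1 / lam j) ^ (n + 2) * (1 - 1 / lam j) ^ k) sums ((- 1) ^ k * (forward_diff ^^ k) m n)" for n k
        using diff_sums[of n k] by (simp add: power_one_over)
    qed (use nonneg in blast)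
    then have "Im (lam n) = 0"
      using lam(2)[of n] by (auto simp: Im_divide complex_eq_iff)
    then show ?thesis
      using lam_Re[of n] by (simp add: n complex_is_Real_iff)
  qed
  then show ?thesis
    using m_sums diff_sums by blast
qed

end
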